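(* Let $S\equiv(S,I,\mathbf d,\mathbf r,\cdot)$ be a partial semigroup, let $i,j\in I$, and suppose $a\in S_{ji}$ is regular. Then the following are equivalent: (i) $S_{ij}^a$ has a nontrivial maximal $\mathscr J^a$-class; (ii) for all $x\in S_{ij}$, $a\leq_{\mathscr J}axa\Rightarrow x\leq_{\mathscr J}a$; (iii) for all $x\in S_{ij}$, $a\,\mathscr J\,axa\Rightarrow x\,\mathscr J\,a$.
   Context: A partial semigroup $(S,I,\mathbf d,\mathbf r,\cdot)$ consists of sets $S,I$, maps $\mathbf d,\mathbf r:S\to I$ and a partial binary operation on $S$ such that: $x\cdot y$ is defined iff $\mathbf r(x)=\mathbf d(y)$, in which case $\mathbf d(xy)=\mathbf d(x)$ and $\mathbf r(xy)=\mathbf r(y)$; and $(xy)z=x(yz)$ whenever $xy$ and $yz$ are defined. $S_{ij}=\{x\in S:\mathbf d(x)=i,\ \mathbf r(x)=j\}$. An element $a\in S$ is regular if $a=axa$ for some $x\in S$. $S^{(1)}$ denotes the category obtained from $S$ by adjoining an identity at each object of $I$ that does not already have one. On $S$: $x\leq_{\mathscr J}y$ iff $x=uyv$ for some $u,v\in S^{(1)}$, and $x\,\mathscr J\,y$ iff $x\leq_{\mathscr J}y\leq_{\mathscr J}x$. For $a\in S_{ji}$, the sandwich semigroup $S_{ij}^a$ is the set $S_{ij}$ with the associative operation $x\star_ay=xay$; $\mathscr J^a$ and $\leq_{\mathscr J^a}$ denote Green's $\mathscr J$ relation and preorder of the semigroup $S_{ij}^a$. The $\mathscr J^a$-classes are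 partially ordered by $J_x^a\leq J_y^a\Leftrightarrow x\leq_{\mathscr J^a}y$; a maximal $\mathscr J^a$-class is one maximal in this order. If $x\in S_{ij}$ satisfies $x\not\leq_{\mathscr J}a$ in $S$, then $\{x\}$ is a maximal $\mathscr J^a$-class; maximal $\mathscr J^a$-classes of this form are called trivial, and any other maximal $\mathscr J^a$-class is called nontrivial. *)

theory Defs
  imports Main
begin

text \<open>
  The partial operation \<open>mul\<close> is a total HOL function whose values carry meaning only on
  composable pairs: the product of \<open>x\<close> and \<open>y\<close> is defined iff \<open>rmap x = dmap y\<close>. Every
  definition below that forms a product therefore states composability explicitly, or is
  restricted to hom-sets in which it holds. Likewise \<open>dmap\<close> and \<open>rmap\<close> matter only on \<open>arr\<close>.
\<close>

record ('a, 'i) psemigroup =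
  arr :: "'a set"
  obj :: "'i set"
  dmap :: "'a \<Rightarrow> 'i"
  rmap :: "'a \<Rightarrow> 'i"
  mul :: "'a \<Rightarrow> 'a \<Rightarrow> 'a"

locale partial_semigroup =
  fixes S :: "('a, 'i) psemigroup"
  assumes dmap_obj: "x \<in> arr S \<Longrightarrow> dmap S x \<in> obj S"
    and rmap_obj: "x \<in> arr S \<Longrightarrow> rmap S x \<in> obj S"
    and mul_arr: "x \<in> arr S \<Longrightarrow> y \<in> arr S \<Longrightarrow> rmap S x = dmap S y \<Longrightarrow> mul S x y \<in> arr S"
    and dmap_mul: "x \<in> arr S \<Longrightarrow> y \<in> arr S \<Longrightarrow> rmap S x = dmap S y \<Longrightarrow>
      dmap S (mul S x y) = dmap S x"
    and rmap_mul: "x \<in> arr S \<Longrightarrow> y \<in> arr S \<Longrightarrow> rmap S x = dmap S y \<Longrightarrow>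
      rmap S (mul S x y) = rmap S y"
    and mul_assoc: "x \<in> arr S \<Longrightarrow> y \<in> arr S \<Longrightarrow> z \<in> arr S \<Longrightarrow>
      rmap S x = dmap S y \<Longrightarrow> rmap S y = dmap S z \<Longrightarrow>
      mul S (mul S x y) z = mul S x (mul S y z)"

definition hom_set :: "('a, 'i) psemigroup \<Rightarrow> 'i \<Rightarrow> 'i \<Rightarrow> 'a set" where
  "hom_set S i j = {x \<in> arr S. dmap S x = i \<and> rmap S x = j}"

definition regular_elem :: "('a, 'i) psemigroup \<Rightarrow> 'a \<Rightarrow> bool" where
  "regular_elem S a \<longleftrightarrow>
     (\<exists>x \<in> arr S. rmap S a = dmap S x \<and> rmap S x = dmap S a \<and> a = mul S (mul S a x) a)"

definition identity_at :: "('a, 'i) psemigroup \<Rightarrow> 'i \<Rightarrow> 'a \<Rightarrow> bool" where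
  "identity_at S i e \<longleftrightarrow> e \<in> hom_set S i i \<and>
     (\<forall>x \<in> arr S. dmap S x = i \<longrightarrow> mul S e x = x) \<and>
     (\<forall>x \<in> arr S. rmap S x = i \<longrightarrow> mul S x e = x)"

text \<open>
  The category \<open>S\<^sup>(\<^sup>1\<^sup>)\<close>: elements of \<open>S\<close> appear as \<open>Inl x\<close>, and \<open>Inr i\<close> is the identity adjoined
  at an object \<open>i\<close> that has none.
\<close>

fun mul1 :: "('a, 'i) psemigroup \<Rightarrow> 'a + 'i \<Rightarrow> 'a + 'i \<Rightarrow> 'a + 'i" where
  "mul1 S (Inl x) (Inl y) = Inl (mul S x y)"
| "mul1 S (Inl x) (Inr j) = Inl x"
| "mul1 S (Inr i) v = v"

definition adjoin_ids :: "('a, 'i) psemigroup \<Rightarrow> ('a + 'i, 'i) psemigroup" where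
  "adjoin_ids S =
     \<lparr>arr = Inl ` arr S \<union> Inr ` {i \<in> obj S. \<nexists>e. identity_at S i e},
      obj = obj S,
      dmap = case_sum (dmap S) (\<lambda>i. i),
      rmap = case_sum (rmap S) (\<lambda>i. i),
      mul = mul1 S\<rparr>"

definition J_le :: "('a, 'i) psemigroup \<Rightarrow> 'a \<Rightarrow> 'a \<Rightarrow> bool" where
  "J_le S x y \<longleftrightarrow> x \<in> arr S \<and> y \<in> arr S \<and>
     (\<exists>u \<in> arr (adjoin_ids S). \<exists>v \<in> arr (adjoin_ids S).
        rmap (adjoin_ids S) u = dmap (adjoin_ids S) (Inl y) \<and>
        rmap (adjoin_ids S) (Inl y) = dmap (adjoin_ids S) v \<and>
        Inl x = mul (adjoin_ids S) (mul (adjoin_ids S) u (Inl y)) v)"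

definition J_rel :: "('a, 'i) psemigroup \<Rightarrow> 'a \<Rightarrow> 'a \<Rightarrow> bool" where
  "J_rel S x y \<longleftrightarrow> J_le S x y \<and> J_le S y x"

definition J_class :: "('a, 'i) psemigroup \<Rightarrow> 'a \<Rightarrow> 'a set" where
  "J_class S x = {y \<in> arr S. J_rel S x y}"

definition J_classes :: "('a, 'i) psemigroup \<Rightarrow> 'a set set" where
  "J_classes S = J_class S ` arr S"

definition J_class_le :: "('a, 'i) psemigroup \<Rightarrow> 'a set \<Rightarrow> 'a set \<Rightarrow> bool" where
  "J_class_le S C D \<longleftrightarrow>
     (\<exists>x \<in> arr S. \<exists>y \<in> arr S. C = J_class S x \<and> D = J_class S y \<and> J_le S x y)"

definition maximal_J_class :: "('a, 'i) psemigroup \<Rightarrow> 'a set \<Rightarrow> bool" where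
  "maximal_J_class S C \<longleftrightarrow>
     C \<in> J_classes S \<and> (\<forall>D \<in> J_classes S. J_class_le S C D \<longrightarrow> D = C)"

text \<open>
  A semigroup is a partial semigroup with exactly one object. So for the sandwich semigroup
  below \<open>adjoin_ids\<close> is the usual monoid completion, and \<open>J_le\<close>, \<open>J_rel\<close> and \<open>J_class\<close> are the
  usual Green's notions of that semigroup.
\<close>

definition sandwich ::
    "('a, 'i) psemigroup \<Rightarrow> 'i \<Rightarrow> 'i \<Rightarrow> 'a \<Rightarrow> ('a, unit) psemigroup" where
  "sandwich S i j a =
     \<lparr>arr = hom_set S i j,
      obj = {()},
      dmap = (\<lambda>_. ()),
      rmap = (\<lambda>_. ()),
      mul = (\<lambda>x y. mul S (mul S x a) y)\<rparr>"

definition trivial_maximal_J_class ::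
    "('a, 'i) psemigroup \<Rightarrow> 'i \<Rightarrow> 'i \<Rightarrow> 'a \<Rightarrow> 'a set \<Rightarrow> bool" where
  "trivial_maximal_J_class S i j a C \<longleftrightarrow>
     maximal_J_class (sandwich S i j a) C \<and>
     (\<exists>x \<in> hom_set S i j. \<not> J_le S x a \<and> C = {x})"

definition nontrivial_maximal_J_class ::
    "('a, 'i) psemigroup \<Rightarrow> 'i \<Rightarrow> 'i \<Rightarrow> 'a \<Rightarrow> 'a set \<Rightarrow> bool" where
  "nontrivial_maximal_J_class S i j a C \<longleftrightarrow>
     maximal_J_class (sandwich S i j a) C \<and> \<not> trivial_maximal_J_class S i j a C"

lemma partial_semigroup_adjoin_ids:
  assumes "partial_semigroup S"
  shows "partial_semigroup (adjoin_ids S)"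
proof -
  interpret partial_semigroup S by fact
  show ?thesis
    by unfold_locales
      (auto simp: adjoin_ids_def dmap_obj rmap_obj mul_arr dmap_mul rmap_mul mul_assoc)
qed

lemma identity_at_adjoin_ids:
  assumes "partial_semigroup S" and "i \<in> obj S"
  shows "\<exists>e. identity_at (adjoin_ids S) i e"
proof (cases "\<exists>e. identity_at S i e")
  case True
  then obtain e where "identity_at S i e" by blast
  then have "identity_at (adjoin_ids S) i (Inl e)"
    by (auto simp: adjoin_ids_def identity_at_def hom_set_def)
  then show ?thesis by blast
next
  case False
  then have "identity_at (adjoin_ids S) i (Inr i)"
    using assms(2) by (auto simp: adjoin_ids_def identity_at_def hom_set_def)
  then show ?thesis by blast
qed

lemma partial_semigroup_sandwich:
  assumes "partial_semigroup S" and "a \<in> hom_set S j i"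
  shows "partial_semigroup (sandwich S i j a)"
proof -
  interpret partial_semigroup S by fact
  show ?thesis
    using assms(2)
    by unfold_locales
      (auto simp: sandwich_def hom_set_def mul_arr dmap_mul rmap_mul mul_assoc)
qed

end

theory Submission
  imports Defs
begin

text \<open>
  Since \<open>a\<close> is regular it has an inverse \<open>b\<close> in the hom-set from \<open>i\<close> to \<open>j\<close>, so that
  \<open>aba = a\<close> and \<open>bab = b\<close>. Everything is controlled by the class of \<open>b\<close> in the sandwich
  semigroup, through two translations, valid for every \<open>x\<close> in that hom-set:
  \<open>x \<le> a\<close> holds in the partial semigroup iff \<open>x \<le> b\<close> holds in the sandwich semigroup
  (\<open>J_le_a_iff\<close>), and \<open>a \<le> axa\<close> holds in the partial semigroup iff \<open>b \<le> x\<close> holds in the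
  sandwich semigroup (\<open>J_le_axa_iff\<close>). Both rest on the fact that a relation \<open>x \<le> y\<close> with \<open>x\<close>
  or \<open>y\<close> regular is witnessed by multipliers that are not adjoined identities
  (\<open>J_le_regular_left\<close>, \<open>J_le_regular_right\<close>); such multipliers can be completed by \<open>a\<close> or
  \<open>b\<close> to factors of the required type.

  By these translations, condition (ii) says exactly that everything above \<open>b\<close> is below \<open>b\<close>,
  that is, that the class of \<open>b\<close> is maximal. This class is never trivial, as \<open>b = bab \<le> a\<close>.
  Conversely, the class of any element \<open>z\<close> with \<open>\<not> z \<le> a\<close> is a singleton, so a nontrivial
  maximal class consists of elements below \<open>a\<close>, hence below \<open>b\<close>, and by maximality it is the
  class of \<open>b\<close>. So (i) also says that the class of \<open>b\<close> is maximal. Finally, (ii) and (iii)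
  are equivalent because \<open>axa \<le> a\<close> always holds and \<open>a \<le> axa\<close> implies \<open>a \<le> x\<close>.
\<close>

section \<open>The order J in a partial semigroup\<close>

lemma adjoin_ids_simps [simp]:
  "dmap (adjoin_ids S) (Inl x) = dmap S x"
  "rmap (adjoin_ids S) (Inl x) = rmap S x"
  "dmap (adjoin_ids S) (Inr k) = k"
  "rmap (adjoin_ids S) (Inr k) = k"
  "mul (adjoin_ids S) = mul1 S"
  "Inl x \<in> arr (adjoin_ids S) \<longleftrightarrow> x \<in> arr S"
  by (auto simp: adjoin_ids_def)

lemma sandwich_simps [simp]:
  "arr (sandwich S i j a) = hom_set S i j"
  "dmap (sandwich S i j a) x = ()"
  "rmap (sandwich S i j a) x = ()"
  "mul (sandwich S i j a) x y = mul S (mul S x a) y"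
  by (auto simp: sandwich_def)

context partial_semigroup
begin

lemma J_le_arr: "J_le S x y \<Longrightarrow> x \<in> arr S \<and> y \<in> arr S"
  by (simp add: J_le_def)

lemma J_leI:
  assumes "x \<in> arr S" "y \<in> arr S" "u \<in> arr (adjoin_ids S)" "v \<in> arr (adjoin_ids S)"
    "rmap (adjoin_ids S) u = dmap S y" "rmap S y = dmap (adjoin_ids S) v"
    "Inl x = mul1 S (mul1 S u (Inl y)) v"
  shows "J_le S x y"
  unfolding J_le_def adjoin_ids_simps using assms by blast

lemma J_le_mulI:
  assumes "y \<in> arr S" "u \<in> arr S" "v \<in> arr S" "rmap S u = dmap S y" "rmap S y = dmap S v"
  shows "J_le S (mul S (mul S u y) v) y"
  by (rule J_leI[of _ _ "Inl u" "Inl v"]) (use assms in \<open>simp_all add: mul_arr rmap_mul\<close>)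

lemma adjoin_ids_identity:
  assumes "k \<in> obj S"
  obtains e where "e \<in> arr (adjoin_ids S)" "dmap (adjoin_ids S) e = k"
    "rmap (adjoin_ids S) e = k"
    "\<And>x. x \<in> arr S \<Longrightarrow> dmap S x = k \<Longrightarrow> mul1 S e (Inl x) = Inl x"
    "\<And>x. x \<in> arr S \<Longrightarrow> rmap S x = k \<Longrightarrow> mul1 S (Inl x) e = Inl x"
proof -
  obtain e where "identity_at (adjoin_ids S) k e"
    using identity_at_adjoin_ids[OF partial_semigroup_axioms assms] by blast
  then show thesis
    by (intro that[of e]) (auto simp: identity_at_def hom_set_def)
qed

lemma J_le_mul_left:
  assumes "y \<in> arr S" "u \<in> arr S" "rmap S u = dmap S y"
  shows "J_le S (mul S u y) y"
proof -
  obtain e where e: "e \<in> arr (adjoin_ids S)" "dmap (adjoin_ids S) e = rmap S y"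
      "\<And>x. x \<in> arr S \<Longrightarrow> rmap S x = rmap S y \<Longrightarrow> mul1 S (Inl x) e = Inl x"
    using adjoin_ids_identity[OF rmap_obj[OF assms(1)]] by metis
  show ?thesis
    by (rule J_leI[of _ _ "Inl u" e]) (use assms e in \<open>simp_all add: mul_arr rmap_mul\<close>)
qed

lemma J_le_mul_right:
  assumes "y \<in> arr S" "v \<in> arr S" "rmap S y = dmap S v"
  shows "J_le S (mul S y v) y"
proof -
  obtain e where e: "e \<in> arr (adjoin_ids S)" "rmap (adjoin_ids S) e = dmap S y"
      "\<And>x. x \<in> arr S \<Longrightarrow> dmap S x = dmap S y \<Longrightarrow> mul1 S e (Inl x) = Inl x"
    using adjoin_ids_identity[OF dmap_obj[OF assms(1)]] by metis
  show ?thesis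
    by (rule J_leI[of _ _ e "Inl v"]) (use assms e in \<open>simp_all add: mul_arr\<close>)
qed

lemma J_le_refl:
  assumes "y \<in> arr S"
  shows "J_le S y y"
proof -
  obtain e where "e \<in> arr (adjoin_ids S)" "rmap (adjoin_ids S) e = dmap S y"
      "\<And>x. x \<in> arr S \<Longrightarrow> dmap S x = dmap S y \<Longrightarrow> mul1 S e (Inl x) = Inl x"
    using adjoin_ids_identity[OF dmap_obj[OF assms]] by metis
  moreover obtain f where "f \<in> arr (adjoin_ids S)" "dmap (adjoin_ids S) f = rmap S y"
      "\<And>x. x \<in> arr S \<Longrightarrow> rmap S x = rmap S y \<Longrightarrow> mul1 S (Inl x) f = Inl x"
    using adjoin_ids_identity[OF rmap_obj[OF assms]] by metis
  ultimately show ?thesis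
    by (intro J_leI[of _ _ e f]) (use assms in simp_all)
qed

lemma J_le_trans:
  assumes "J_le S x y" "J_le S y z"
  shows "J_le S x z"
proof -
  let ?A = "adjoin_ids S"
  interpret A: partial_semigroup ?A
    by (rule partial_semigroup_adjoin_ids[OF partial_semigroup_axioms])
  obtain u v where uv: "u \<in> arr ?A" "v \<in> arr ?A"
      "rmap ?A u = dmap ?A (Inl y)" "rmap ?A (Inl y) = dmap ?A v"
      "Inl x = mul ?A (mul ?A u (Inl y)) v"
    using assms(1) unfolding J_le_def by blast
  obtain s t where st: "s \<in> arr ?A" "t \<in> arr ?A"
      "rmap ?A s = dmap ?A (Inl z)" "rmap ?A (Inl z) = dmap ?A t"
      "Inl y = mul ?A (mul ?A s (Inl z)) t"
    using assms(2) unfolding J_le_def by blast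
  have z: "Inl z \<in> arr ?A" using J_le_arr[OF assms(2)] by simp
  have c: "rmap ?A u = dmap ?A s" "rmap ?A t = dmap ?A v"
    using uv(3,4) unfolding st(5) using st(1-4) z
    by (simp_all add: A.mul_arr A.dmap_mul A.rmap_mul del: adjoin_ids_simps)
  have "Inl x = mul ?A (mul ?A (mul ?A u s) (Inl z)) (mul ?A t v)"
    unfolding uv(5) st(5) using uv(1,2) st(1-4) z c
    by (simp add: A.mul_arr A.dmap_mul A.rmap_mul A.mul_assoc del: adjoin_ids_simps)
  moreover have "mul ?A u s \<in> arr ?A" "mul ?A t v \<in> arr ?A"
      "rmap ?A (mul ?A u s) = dmap ?A (Inl z)" "rmap ?A (Inl z) = dmap ?A (mul ?A t v)"
    using uv(1,2) st(1-4) c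
    by (simp_all add: A.mul_arr A.dmap_mul A.rmap_mul del: adjoin_ids_simps)
  ultimately show ?thesis
    unfolding J_le_def using J_le_arr[OF assms(1)] J_le_arr[OF assms(2)] by blast
qed

lemma J_le_cases:
  assumes "J_le S x y"
  obtains (eq) "x = y"
  | (left) u where "u \<in> arr S" "rmap S u = dmap S y" "x = mul S u y"
  | (right) v where "v \<in> arr S" "rmap S y = dmap S v" "x = mul S y v"
  | (both) u v where "u \<in> arr S" "v \<in> arr S" "rmap S u = dmap S y" "rmap S y = dmap S v"
      "x = mul S (mul S u y) v"
proof -
  obtain u v where uv: "u \<in> arr (adjoin_ids S)" "v \<in> arr (adjoin_ids S)"
      "rmap (adjoin_ids S) u = dmap S y" "rmap S y = dmap (adjoin_ids S) v"
      "Inl x = mul1 S (mul1 S u (Inl y)) v"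
    using assms unfolding J_le_def by auto
  show thesis
    using uv by (cases u; cases v) (auto intro: that)
qed

text \<open>
  Below a regular element the adjoined identities are not needed: if \<open>y = ywy\<close>, then the
  elements \<open>yw\<close> and \<open>wy\<close> of \<open>S\<close> act on \<open>y\<close> as a left and a right identity.
\<close>

lemma J_le_regular_right:
  assumes "J_le S x y" "regular_elem S y"
  obtains u v where "u \<in> arr S" "v \<in> arr S" "rmap S u = dmap S y" "rmap S y = dmap S v"
    "x = mul S (mul S u y) v"
proof -
  have y: "y \<in> arr S" using J_le_arr[OF assms(1)] by simp
  obtain w where w: "w \<in> arr S" "rmap S y = dmap S w" "rmap S w = dmap S y"
      "y = mul S (mul S y w) y"
    using assms(2) unfolding regular_elem_def by blast
  have l: "mul S (mul S y w) y = y" and r: "mul S y (mul S w y) = y"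
    using w y by (simp_all flip: mul_assoc)
  show thesis
    using assms(1)
  proof (cases rule: J_le_cases)
    case eq
    then show ?thesis
      using w y l r
      by (intro that[of "mul S y w" "mul S w y"]) (simp_all add: mul_arr dmap_mul rmap_mul)
  next
    case (left u)
    then have "mul S (mul S u y) (mul S w y) = mul S u (mul S y (mul S w y))"
      using w y by (intro mul_assoc) (simp_all add: mul_arr dmap_mul)
    then show ?thesis
      using left w y r by (intro that[of u "mul S w y"]) (simp_all add: mul_arr dmap_mul)
  next
    case (right v)
    then show ?thesis
      using w y l by (intro that[of "mul S y w" v]) (simp_all add: mul_arr rmap_mul)
  next
    case (both u v)
    then show ?thesis by (rule that)
  qed
qed

text \<open>
  The same holds above a regular element: if \<open>x = xwx\<close> and \<open>x = uyv\<close>, then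
  \<open>x = (xwu)y(vwx)\<close>, so \<open>u\<close> and \<open>v\<close> may be replaced by elements of \<open>S\<close>.
\<close>

lemma J_le_regular_left:
  assumes "J_le S x y" "regular_elem S x"
  obtains u v where "u \<in> arr S" "v \<in> arr S" "rmap S u = dmap S y" "rmap S y = dmap S v"
    "x = mul S (mul S u y) v"
proof -
  have xy: "x \<in> arr S" "y \<in> arr S" using J_le_arr[OF assms(1)] by simp_all
  obtain w where w: "w \<in> arr S" "rmap S x = dmap S w" "rmap S w = dmap S x"
      "x = mul S (mul S x w) x"
    using assms(2) unfolding regular_elem_def by blast
  let ?p = "mul S x w" and ?q = "mul S w x"
  have pq: "?p \<in> arr S" "?q \<in> arr S" "dmap S ?p = dmap S x" "rmap S ?p = dmap S x"
      "dmap S ?q = rmap S x" "rmap S ?q = rmap S x"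
    using w xy by (simp_all add: mul_arr dmap_mul rmap_mul)
  have x: "x = mul S (mul S ?p x) ?q"
    using w xy pq by (simp flip: mul_assoc)
  show thesis
    using assms(1)
  proof (cases rule: J_le_cases)
    case eq
    then show ?thesis using pq x by (intro that[of ?p ?q]) simp_all
  next
    case (left u)
    have d: "dmap S x = dmap S u" "rmap S x = rmap S y"
      using left xy by (simp_all add: dmap_mul rmap_mul)
    have "mul S (mul S (mul S ?p u) y) ?q = mul S (mul S ?p x) ?q"
      using left xy pq d by (simp add: mul_assoc)
    then show ?thesis
      using left xy pq d x
      by (intro that[of "mul S ?p u" ?q]) (simp_all add: mul_arr rmap_mul)
  next
    case (right v)
    have d: "dmap S x = dmap S y" "rmap S x = rmap S v"
      using right xy by (simp_all add: dmap_mul rmap_mul)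
    have "mul S (mul S ?p y) (mul S v ?q) = mul S (mul S ?p x) ?q"
      using right xy pq d by (simp add: mul_assoc mul_arr dmap_mul rmap_mul)
    then show ?thesis
      using right xy pq d x
      by (intro that[of ?p "mul S v ?q"]) (simp_all add: mul_arr dmap_mul)
  next
    case (both u v)
    then show ?thesis by (rule that)
  qed
qed

lemma J_class_eq_iff:
  assumes "x \<in> arr S" "y \<in> arr S"
  shows "J_class S x = J_class S y \<longleftrightarrow> J_le S x y \<and> J_le S y x"
proof
  assume "J_class S x = J_class S y"
  moreover have "y \<in> J_class S y" using J_le_refl assms by (simp add: J_class_def J_rel_def)
  ultimately have "y \<in> J_class S x" by simp
  then show "J_le S x y \<and> J_le S y x" by (simp add: J_class_def J_rel_def)
next
  assume "J_le S x y \<and> J_le S y x"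
  then show "J_class S x = J_class S y"
    using J_le_trans by (auto simp: J_class_def J_rel_def)
qed

lemma maximal_J_class_iff:
  assumes "x \<in> arr S"
  shows "maximal_J_class S (J_class S x) \<longleftrightarrow> (\<forall>y \<in> arr S. J_le S x y \<longrightarrow> J_le S y x)"
proof
  assume m: "maximal_J_class S (J_class S x)"
  show "\<forall>y \<in> arr S. J_le S x y \<longrightarrow> J_le S y x"
  proof (intro ballI impI)
    fix y assume y: "y \<in> arr S" "J_le S x y"
    have "J_class_le S (J_class S x) (J_class S y)"
      using assms y unfolding J_class_le_def by blast
    then have "J_class S y = J_class S x"
      using m y(1) unfolding maximal_J_class_def J_classes_def by blast
    then show "J_le S y x" using J_class_eq_iff assms y(1) by blast
  qed
next
  assume m: "\<forall>y \<in> arr S. J_le S x y \<longrightarrow> J_le S y x"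
  have "D = J_class S x" if le: "J_class_le S (J_class S x) D" for D
  proof -
    obtain s t where st: "s \<in> arr S" "t \<in> arr S" "J_class S x = J_class S s"
        "D = J_class S t" "J_le S s t"
      using le unfolding J_class_le_def by blast
    have "J_le S x t" using J_class_eq_iff[OF assms st(1)] st(3,5) J_le_trans by blast
    then show ?thesis using m st(2,4) J_class_eq_iff[OF st(2) assms] by blast
  qed
  then show "maximal_J_class S (J_class S x)"
    using assms unfolding maximal_J_class_def J_classes_def by blast
qed

end

section \<open>Sandwich semigroups of regular elements\<close>

text \<open>A sandwich element \<open>a\<close> from \<open>j\<close> to \<open>i\<close> together with an inverse \<open>b\<close> from \<open>i\<close> to \<open>j\<close>.\<close>

locale regular_sandwich = partial_semigroup S for S :: "('a, 'i) psemigroup" +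
  fixes i j :: 'i and a b :: 'a
  assumes a_hom: "a \<in> hom_set S j i" and b_hom: "b \<in> hom_set S i j"
    and aba: "mul S (mul S a b) a = a" and bab: "mul S (mul S b a) b = b"
begin

abbreviation "T \<equiv> sandwich S i j a"

sublocale T: partial_semigroup T
  by (rule partial_semigroup_sandwich[OF partial_semigroup_axioms a_hom])

lemma hom_mul:
  "x \<in> hom_set S k l \<Longrightarrow> y \<in> hom_set S l m \<Longrightarrow> mul S x y \<in> hom_set S k m"
  by (auto simp: hom_set_def mul_arr dmap_mul rmap_mul)

lemma hom_assoc:
  "x \<in> hom_set S k l \<Longrightarrow> y \<in> hom_set S l m \<Longrightarrow> z \<in> hom_set S m n \<Longrightarrow>
    mul S (mul S x y) z = mul S x (mul S y z)"
  by (auto simp: hom_set_def mul_assoc)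

lemmas hom_simps = hom_set_def mul_arr dmap_mul rmap_mul mul_assoc

lemma a_regular: "regular_elem S a"
  using a_hom b_hom aba unfolding regular_elem_def
  by (auto simp: hom_set_def intro!: bexI[of _ b])

lemma J_le_hom_left: "y \<in> hom_set S k l \<Longrightarrow> u \<in> hom_set S m k \<Longrightarrow> J_le S (mul S u y) y"
  by (auto simp: hom_set_def J_le_mul_left)

lemma J_le_hom_right: "y \<in> hom_set S k l \<Longrightarrow> v \<in> hom_set S l m \<Longrightarrow> J_le S (mul S y v) y"
  by (auto simp: hom_set_def J_le_mul_right)

lemma J_le_mid: "u \<in> hom_set S k j \<Longrightarrow> v \<in> hom_set S i l \<Longrightarrow> J_le S (mul S (mul S u a) v) a"
  using J_le_mulI[of a u v] a_hom by (auto simp: hom_set_def)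

lemma b_J_le_a: "J_le S b a"
  using J_le_mid[OF b_hom b_hom] by (simp add: bab)

lemma b_regular: "regular_elem T b"
  unfolding regular_elem_def using b_hom by (auto simp: bab intro!: bexI[of _ b])

lemma sandwich_J_le_imp:
  assumes "J_le T x y"
  shows "J_le S x y"
proof -
  have y: "y \<in> hom_set S i j" using T.J_le_arr[OF assms] by simp
  show ?thesis
    using assms
  proof (cases rule: T.J_le_cases)
    case eq
    then show ?thesis using y J_le_refl by (simp add: hom_set_def)
  next
    case (left u)
    then show ?thesis by (auto intro: J_le_hom_left[OF y] hom_mul[OF _ a_hom])
  next
    case (right v)
    then have v: "v \<in> hom_set S i j" and x: "x = mul S y (mul S a v)"
      using hom_assoc[OF y a_hom, of v] by simp_all
    show ?thesis unfolding x by (rule J_le_hom_right[OF y hom_mul[OF a_hom v]])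
  next
    case (both u v)
    then have u: "mul S u a \<in> hom_set S i i" and v: "mul S a v \<in> hom_set S j j"
      using a_hom by (auto intro: hom_mul)
    have "x = mul S (mul S (mul S u a) y) (mul S a v)"
      using both y a_hom by (simp add: hom_simps)
    then show ?thesis
      using J_le_mulI[of y "mul S u a" "mul S a v"] u v y by (auto simp: hom_set_def)
  qed
qed

text \<open>Every product \<open>uav\<close> equals \<open>uabav\<close>, which is a product in the sandwich semigroup.\<close>

lemma J_le_a_iff:
  assumes x: "x \<in> hom_set S i j"
  shows "J_le S x a \<longleftrightarrow> J_le T x b"
proof
  assume "J_le S x a"
  then obtain u v where uv: "u \<in> arr S" "v \<in> arr S" "rmap S u = dmap S a" "rmap S a = dmap S v"
      "x = mul S (mul S u a) v"
    using J_le_regular_right a_regular by blast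
  have "dmap S x = dmap S u" "rmap S x = rmap S v"
    using uv a_hom by (auto simp: hom_set_def mul_arr dmap_mul rmap_mul)
  then have h: "u \<in> hom_set S i j" "v \<in> hom_set S i j"
    using uv x a_hom by (auto simp: hom_set_def)
  have "mul S (mul S (mul S u a) b) a = mul S u a"
    using h(1) a_hom b_hom aba by (simp add: hom_simps)
  then have "x = mul T (mul T u b) v" using uv(5) by simp
  then show "J_le T x b" using T.J_le_mulI[of b u v] h b_hom by simp
next
  assume "J_le T x b"
  then show "J_le S x a" using sandwich_J_le_imp b_J_le_a J_le_trans by blast
qed

lemma J_le_axa_iff:
  assumes x: "x \<in> hom_set S i j"
  shows "J_le S a (mul S (mul S a x) a) \<longleftrightarrow> J_le T b x"
proof
  let ?w = "mul S (mul S a x) a"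
  have w: "?w \<in> hom_set S j i" using a_hom x by (auto intro: hom_mul)
  assume "J_le S a ?w"
  then obtain u v where uv: "u \<in> arr S" "v \<in> arr S" "rmap S u = dmap S ?w" "rmap S ?w = dmap S v"
      "a = mul S (mul S u ?w) v"
    using J_le_regular_left a_regular by blast
  have "dmap S (mul S (mul S u ?w) v) = dmap S u" "rmap S (mul S (mul S u ?w) v) = rmap S v"
    using uv(1-4) w by (auto simp: hom_set_def mul_arr dmap_mul rmap_mul)
  then have h: "u \<in> hom_set S j j" "v \<in> hom_set S i i"
    using uv w a_hom by (auto simp: hom_set_def)
  let ?s = "mul S b u" and ?t = "mul S v b"
  have st: "?s \<in> hom_set S i j" "?t \<in> hom_set S i j" using h b_hom by (auto intro: hom_mul)
  \<comment> \<open>Substituting \<open>a = u(axa)v\<close> into \<open>b = bab\<close> gives \<open>b = (bu)axa(vb)\<close>.\<close>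
  have "mul S (mul S (mul S (mul S ?s a) x) a) ?t = mul S ?s (mul S ?w ?t)"
    using st a_hom x by (simp add: hom_simps)
  also have "\<dots> = mul S (mul S b (mul S (mul S u ?w) v)) b"
    using h a_hom x b_hom by (simp add: hom_simps)
  also have "\<dots> = b" using uv(5) bab by simp
  finally have "b = mul T (mul T ?s x) ?t" by simp
  then show "J_le T b x" using T.J_le_mulI[of x ?s ?t] st x by simp
next
  let ?w = "mul S (mul S a x) a"
  have w: "?w \<in> hom_set S j i" using a_hom x by (auto intro: hom_mul)
  assume "J_le T b x"
  then obtain s t where st: "s \<in> hom_set S i j" "t \<in> hom_set S i j"
      "b = mul T (mul T s x) t"
    using T.J_le_regular_left b_regular by (metis sandwich_simps(1))
  have d: "mul S a s \<in> hom_set S j j" "mul S t a \<in> hom_set S i i"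
    using st a_hom by (auto intro: hom_mul)
  \<comment> \<open>Substituting \<open>b = saxat\<close> into \<open>a = aba\<close> gives \<open>a = (as)axa(ta)\<close>.\<close>
  have "b = mul S s (mul S ?w t)"
    using st(1,2) a_hom x by (subst st(3)) (simp add: hom_simps)
  then have "a = mul S (mul S a (mul S s (mul S ?w t))) a" using aba by simp
  also have "\<dots> = mul S (mul S (mul S a s) ?w) (mul S t a)"
    using st(1,2) a_hom x by (simp add: hom_simps)
  finally show "J_le S a ?w"
    using J_le_mulI[of ?w "mul S a s" "mul S t a"] d w by (auto simp: hom_set_def)
qed

text \<open>
  A relation \<open>z \<le> y\<close> in the sandwich semigroup with \<open>z \<noteq> y\<close> makes \<open>z\<close> a product in which
  \<open>a\<close> occurs.
\<close>

lemma J_le_sandwich_neq: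
  assumes "J_le T z y" "z \<noteq> y"
  shows "J_le S z a"
proof -
  have y: "y \<in> hom_set S i j" using T.J_le_arr[OF assms(1)] by simp
  show ?thesis
    using assms(1)
  proof (cases rule: T.J_le_cases)
    case eq
    then show ?thesis using assms(2) by simp
  next
    case (left u)
    then show ?thesis using J_le_mid[OF _ y] by simp
  next
    case (right v)
    then show ?thesis using J_le_mid[OF y] by simp
  next
    case (both u v)
    then have "mul S (mul S u a) y \<in> hom_set S i j" using a_hom y by (auto intro: hom_mul)
    then show ?thesis using both J_le_mid by simp
  qed
qed

lemma nontrivial_class_exists_iff:
  "(\<exists>C. nontrivial_maximal_J_class S i j a C) \<longleftrightarrow> maximal_J_class T (J_class T b)"
proof
  assume "\<exists>C. nontrivial_maximal_J_class S i j a C"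
  then obtain C where C: "maximal_J_class T C" "\<not> trivial_maximal_J_class S i j a C"
    unfolding nontrivial_maximal_J_class_def by blast
  then obtain z where z: "z \<in> hom_set S i j" "C = J_class T z"
    unfolding maximal_J_class_def J_classes_def by auto
  have "J_le S z a"
  proof (rule ccontr)
    assume n: "\<not> J_le S z a"
    then have "C = {z}"
      using z J_le_sandwich_neq T.J_le_refl by (auto simp: J_class_def J_rel_def)
    then show False using n z(1) C unfolding trivial_maximal_J_class_def by blast
  qed
  then have "J_le T z b" using J_le_a_iff z(1) by simp
  moreover from this have "J_le T b z"
    using C(1) z b_hom T.maximal_J_class_iff[of z] by simp
  ultimately have "J_class T z = J_class T b"
    using T.J_class_eq_iff[of z b] z(1) b_hom by simp
  then show "maximal_J_class T (J_class T b)" using C(1) z(2) by simp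
next
  assume m: "maximal_J_class T (J_class T b)"
  have "b \<in> J_class T b"
    using T.J_le_refl[of b] b_hom by (simp add: J_class_def J_rel_def)
  then have "\<not> trivial_maximal_J_class S i j a (J_class T b)"
    using b_J_le_a unfolding trivial_maximal_J_class_def by auto
  then show "\<exists>C. nontrivial_maximal_J_class S i j a C"
    using m unfolding nontrivial_maximal_J_class_def by blast
qed

lemma maximal_class_b_iff:
  "maximal_J_class T (J_class T b) \<longleftrightarrow>
    (\<forall>x \<in> hom_set S i j. J_le S a (mul S (mul S a x) a) \<longrightarrow> J_le S x a)"
  using T.maximal_J_class_iff[of b] b_hom J_le_a_iff J_le_axa_iff by simp

lemma J_rel_axa_iff:
  assumes x: "x \<in> hom_set S i j"
  shows "J_rel S a (mul S (mul S a x) a) \<longleftrightarrow> J_le S a (mul S (mul S a x) a)"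
  using J_le_hom_left[OF a_hom hom_mul[OF a_hom x]] by (auto simp: J_rel_def)

lemma J_le_axa_imp:
  assumes x: "x \<in> hom_set S i j" and "J_le S a (mul S (mul S a x) a)"
  shows "J_le S a x"
  using J_le_mulI[of x a a] x a_hom J_le_trans[OF assms(2)] by (auto simp: hom_set_def)

end

lemma (in partial_semigroup) regular_elem_has_inverse:
  assumes "a \<in> hom_set S j i" "regular_elem S a"
  obtains b where "regular_sandwich S i j a b"
proof -
  obtain y where y: "y \<in> arr S" "rmap S a = dmap S y" "rmap S y = dmap S a"
      "a = mul S (mul S a y) a"
    using assms(2) unfolding regular_elem_def by blast
  have a: "a \<in> arr S" "dmap S a = j" "rmap S a = i" using assms(1) by (auto simp: hom_set_def)
  have aya: "mul S a (mul S y a) = a" using y a by (simp flip: mul_assoc)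
  have ayaz: "mul S a (mul S y (mul S a z)) = mul S a z" if "z \<in> arr S" "dmap S z = i" for z
  proof -
    have "mul S a (mul S y (mul S a z)) = mul S (mul S a (mul S y a)) z"
      using y(1-3) a that by (simp add: mul_assoc mul_arr dmap_mul rmap_mul)
    then show ?thesis by (simp add: aya)
  qed
  \<comment> \<open>The element \<open>y\<close> need not satisfy \<open>yay = y\<close>, but \<open>yay\<close> is an inverse of \<open>a\<close>.\<close>
  let ?b = "mul S (mul S y a) y"
  have "regular_sandwich S i j a ?b"
    using y(1-3) a aya ayaz assms(1)
    by unfold_locales (auto simp: hom_set_def mul_arr dmap_mul rmap_mul mul_assoc)
  then show thesis by (rule that)
qed

theorem proposition3p11:
  fixes S :: "('a, 'i) psemigroup" and i j :: 'i and a :: 'a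
  assumes "partial_semigroup S"
    and "i \<in> obj S" and "j \<in> obj S"
    and "a \<in> hom_set S j i"
    and "regular_elem S a"
  shows "((\<exists>C. nontrivial_maximal_J_class S i j a C) \<longleftrightarrow>
            (\<forall>x \<in> hom_set S i j. J_le S a (mul S (mul S a x) a) \<longrightarrow> J_le S x a)) \<and>
         ((\<forall>x \<in> hom_set S i j. J_le S a (mul S (mul S a x) a) \<longrightarrow> J_le S x a) \<longleftrightarrow>
            (\<forall>x \<in> hom_set S i j. J_rel S a (mul S (mul S a x) a) \<longrightarrow> J_rel S x a))"
proof -
  obtain b where "regular_sandwich S i j a b"
    using partial_semigroup.regular_elem_has_inverse[OF assms(1,4,5)] by blast
  then interpret regular_sandwich S i j a b .
  show ?thesis
    using nontrivial_class_exists_iff maximal_class_b_iff J_rel_axa_iff J_le_axa_imp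
    by (auto simp: J_rel_def)
qed

end
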